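(* For the SGUM based random access control game, each user's SNE strategy decreases when its social ties with others increase.
   Context: SGUM stands for social group utility maximization. Users $\mathcal N=\{1,\dots,N\}$; user $i$ is a link with transmitter $T_i$ and receiver $R_i$. $\mathcal I_i^+$ is the set of (other) users whose receivers are interfered with by $T_i$, and $\mathcal I_i^-$ is the set of (other) users whose transmitters cause interference to $R_i$. In a time slot user $i$ contends for transmission with probability $q_i\in[0,1]$, and grabs the transmission opportunity with probability $b_i(q_i,q_{-i})=q_i\prod_{j\in\mathcal I_i^-}(1-q_j)$, where $q_{-i}$ denotes the other users' strategies. The individual utility of user $i$ is $U_i(q_i,q_{-i})=\log(z_ib_i(q_i,q_{-i}))-c_iq_i$ with $z_i>0$, $c_i>0$. $\mathcal N_i^s$ is the set of users having a social tie with user $i$, and $w_{ij}\in[0,1]$ is the strength of user $i$'s social tie with user $j$ (no tie corresponds to $w_{ij}=0$). The social group utility of user $i$ is $S_i=U_i+\sum_{j\in\mathcal N_i^s}w_{ij}U_j$. The SGUM based random access control game is the strategic game with players $\mathcal N$, strategies $q_i$ and payoffs $S_i$. A socially-aware Nash equilibrium (SNE) is a strategy profile at which no player can improve its social group utility by unilaterally changing its strategy. The SNE of this game, which the paper shows to be unique, is given for each $i\in\mathcal N$ by $$q_i^{SNE}=\frac{\sum_{j\in\mathcal I_i^+}w_{ij}+1+c_i-\sqrt{\left(\sum_{j\in\mathcal I_i^+}w_{ij}+1+c_i\right)^2-4c_i}}{2c_i}.$$ *)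

theory Defs
  imports Complex_Main "HOL-Library.Extended_Real"
begin

text \<open>
  A network has a finite type \<open>'u\<close> of users (transmitter-receiver links).
  \<open>interf i j\<close> means that the transmitter of user \<open>i\<close> interferes with the receiver of
  user \<open>j\<close>; \<open>z\<close> and \<open>c\<close> are the utility parameters, \<open>w i j\<close> is the strength of the
  social tie of user \<open>i\<close> with user \<open>j\<close>, and \<open>q\<close> is a profile of contention probabilities.
\<close>

definition interfered :: "('u \<Rightarrow> 'u \<Rightarrow> bool) \<Rightarrow> 'u \<Rightarrow> 'u set" where
  "interfered interf i = {j. j \<noteq> i \<and> interf i j}"

definition interferers :: "('u \<Rightarrow> 'u \<Rightarrow> bool) \<Rightarrow> 'u \<Rightarrow> 'u set" where
  "interferers interf i = {j. j \<noteq> i \<and> interf j i}"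

definition social_neighbours :: "('u \<Rightarrow> 'u \<Rightarrow> real) \<Rightarrow> 'u \<Rightarrow> 'u set" where
  "social_neighbours w i = {j. j \<noteq> i \<and> w i j \<noteq> 0}"

definition grab_prob :: "('u::finite \<Rightarrow> 'u \<Rightarrow> bool) \<Rightarrow> ('u \<Rightarrow> real) \<Rightarrow> 'u \<Rightarrow> real" where
  "grab_prob interf q i = q i * (\<Prod>j\<in>interferers interf i. (1 - q j))"

text \<open>
  Strategies range over the closed interval from 0 to 1, so the argument of the logarithm
  can be 0.  The library function \<open>ln\<close> has \<open>ln 0 = 0\<close>, which would reward a user for
  never grabbing the channel; here the logarithm of 0 is \<open>-\<infinity>\<close>.
\<close>

definition elog :: "real \<Rightarrow> ereal" where
  "elog x = (if x > 0 then ereal (ln x) else -\<infinity>)"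

definition utility ::
  "('u::finite \<Rightarrow> 'u \<Rightarrow> bool) \<Rightarrow> ('u \<Rightarrow> real) \<Rightarrow> ('u \<Rightarrow> real) \<Rightarrow> ('u \<Rightarrow> real) \<Rightarrow> 'u \<Rightarrow> ereal" where
  "utility interf z c q i = elog (z i * grab_prob interf q i) - ereal (c i * q i)"

definition social_group_utility ::
  "('u::finite \<Rightarrow> 'u \<Rightarrow> bool) \<Rightarrow> ('u \<Rightarrow> real) \<Rightarrow> ('u \<Rightarrow> real) \<Rightarrow> ('u \<Rightarrow> 'u \<Rightarrow> real)
    \<Rightarrow> ('u \<Rightarrow> real) \<Rightarrow> 'u \<Rightarrow> ereal" where
  "social_group_utility interf z c w q i =
     utility interf z c q i
     + (\<Sum>j\<in>social_neighbours w i. ereal (w i j) * utility interf z c q j)"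

definition nash_equilibrium ::
  "('u \<Rightarrow> 's set) \<Rightarrow> (('u \<Rightarrow> 's) \<Rightarrow> 'u \<Rightarrow> 'p::order) \<Rightarrow> ('u \<Rightarrow> 's) \<Rightarrow> bool" where
  "nash_equilibrium X S q \<longleftrightarrow>
     (\<forall>i. q i \<in> X i) \<and> (\<forall>i. \<forall>x\<in>X i. \<not> S q i < S (q(i := x)) i)"

definition is_SNE ::
  "('u::finite \<Rightarrow> 'u \<Rightarrow> bool) \<Rightarrow> ('u \<Rightarrow> real) \<Rightarrow> ('u \<Rightarrow> real) \<Rightarrow> ('u \<Rightarrow> 'u \<Rightarrow> real)
    \<Rightarrow> ('u \<Rightarrow> real) \<Rightarrow> bool" where
  "is_SNE interf z c w q \<longleftrightarrow>
     nash_equilibrium (\<lambda>i. {0..1}) (social_group_utility interf z c w) q"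

text \<open>
  The smaller root of \<open>c i * x\<^sup>2 - A * x + 1 = 0\<close>, which is the first-order condition
  \<open>1 / x - c i - (\<Sum>j\<in>interfered interf i. w i j) / (1 - x) = 0\<close> for maximising the social group
  utility of user \<open>i\<close> over its own strategy \<open>x\<close>.
\<close>

definition q_SNE ::
  "('u::finite \<Rightarrow> 'u \<Rightarrow> bool) \<Rightarrow> ('u \<Rightarrow> real) \<Rightarrow> ('u \<Rightarrow> 'u \<Rightarrow> real) \<Rightarrow> 'u \<Rightarrow> real" where
  "q_SNE interf c w i =
     (let A = (\<Sum>j\<in>interfered interf i. w i j) + 1 + c i
      in (A - sqrt (A\<^sup>2 - 4 * c i)) / (2 * c i))"

end

theory Submission
  imports Defs
begin

text \<open>
  As a function of its own strategy \<open>x\<close>, the social group utility of user \<open>i\<close> is either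
  \<open>-\<infinity>\<close> or a constant plus \<open>ln x - c x + W ln (1 - x)\<close>, where \<open>W\<close> is the sum of the ties
  of \<open>i\<close> with the users it interferes with.  This concave function has a unique maximiser,
  which does not depend on the strategies of the others, so the maximisers form an
  equilibrium.  With \<open>A = W + 1 + c\<close> the maximiser equals
  \<open>2 / (A + sqrt (A\<^sup>2 - 4 c))\<close>, which is visibly decreasing in \<open>W\<close>.
\<close>

section \<open>The root of the first-order condition: closed form, bounds, monotonicity\<close>

definition tie_root :: "real \<Rightarrow> real \<Rightarrow> real" where
  "tie_root c W = 2 / (W + 1 + c + sqrt ((W + 1 + c)\<^sup>2 - 4 * c))"

text \<open>The bound is the value of the discriminant at \<open>W = 0\<close>. It gives more than
  nonnegativity: its square root is what locates the root relative to 1.\<close>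

lemma discriminant_ge:
  fixes c W :: real
  assumes "c > 0" "W \<ge> 0"
  shows "(1 - c)\<^sup>2 \<le> (W + 1 + c)\<^sup>2 - 4 * c"
proof -
  have "(W + 1 + c)\<^sup>2 - 4 * c - (1 - c)\<^sup>2 = W * (W + 2 * (1 + c))"
    by (simp add: power2_eq_square algebra_simps)
  moreover have "\<dots> \<ge> 0" using assms by simp
  ultimately show ?thesis by linarith
qed

text \<open>Both signs of the absolute value matter: \<open>1 - c\<close> bounds the denominator of
  \<open>tie_root\<close> below by \<open>W + 2\<close>, so the root is at most 1, and
  \<open>c - 1\<close> gives \<open>c \<le> 1\<close> when the root equals 1.\<close>

lemma sqrt_discriminant_ge:
  fixes c W :: real
  assumes "c > 0" "W \<ge> 0"
  shows "\<bar>1 - c\<bar> \<le> sqrt ((W + 1 + c)\<^sup>2 - 4 * c)"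
  using real_sqrt_le_mono[OF discriminant_ge[OF assms]] by (simp only: real_sqrt_abs)

text \<open>Rationalising the numerator: with \<open>A = W + 1 + c\<close> and \<open>s\<close> the
  square root, \<open>(A - s) * (A + s) = 4 * c\<close>.\<close>

lemma tie_root_eq:
  assumes "c > 0" "W \<ge> 0"
  shows "(W + 1 + c - sqrt ((W + 1 + c)\<^sup>2 - 4 * c)) / (2 * c) = tie_root c W"
proof -
  define s where "s = sqrt ((W + 1 + c)\<^sup>2 - 4 * c)"
  have "(W + 1 + c)\<^sup>2 - 4 * c \<ge> 0"
    using discriminant_ge[OF assms] zero_le_power2[of "1 - c"] by linarith
  then have "s * s = (W + 1 + c)\<^sup>2 - 4 * c" by (simp add: s_def)
  then have "(W + 1 + c - s) * (W + 1 + c + s) = 2 * (2 * c)"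
    by (simp add: power2_eq_square algebra_simps)
  moreover have "W + 1 + c + s > 0"
    using sqrt_discriminant_ge[OF assms] assms by (simp add: s_def)
  ultimately show ?thesis
    using assms by (simp add: tie_root_def s_def[symmetric] frac_eq_eq)
qed

lemma tie_root_pos:
  assumes "c > 0" "W \<ge> 0"
  shows "tie_root c W > 0"
  unfolding tie_root_def
  using sqrt_discriminant_ge[OF assms] assms by (intro divide_pos_pos) linarith+

lemma tie_root_le_1:
  assumes "c > 0" "W \<ge> 0"
  shows "tie_root c W \<le> 1"
proof -
  have "2 \<le> W + 1 + c + sqrt ((W + 1 + c)\<^sup>2 - 4 * c)"
    using sqrt_discriminant_ge[OF assms] assms by linarith
  then show ?thesis unfolding tie_root_def by (subst divide_le_eq_1_pos) linarith+
qed

lemma tie_root_less_1: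
  assumes "c > 0" "W > 0"
  shows "tie_root c W < 1"
proof -
  have "2 < W + 1 + c + sqrt ((W + 1 + c)\<^sup>2 - 4 * c)"
    using sqrt_discriminant_ge[of c W] assms by linarith
  then show ?thesis unfolding tie_root_def by (subst divide_less_eq_1_pos) linarith+
qed

text \<open>Serves the boundary case of the maximisation: at a maximiser 1 the slope
  \<open>1 - c\<close> may be positive but not negative.\<close>

lemma tie_root_eq_1D:
  assumes "c > 0" "W \<ge> 0" "tie_root c W = 1"
  shows "c \<le> 1"
proof -
  have "W + 1 + c + sqrt ((W + 1 + c)\<^sup>2 - 4 * c) = 2"
    using assms(3) by (simp add: tie_root_def divide_eq_1_iff)
  then show ?thesis using sqrt_discriminant_ge[OF assms(1,2)] assms by linarith
qed

lemma tie_root_strict_antimono: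
  assumes "c > 0" "0 \<le> W" "W < W'"
  shows "tie_root c W' < tie_root c W"
proof -
  have "(W + 1 + c)\<^sup>2 \<le> (W' + 1 + c)\<^sup>2"
    using assms by (intro power_mono) auto
  then have "sqrt ((W + 1 + c)\<^sup>2 - 4 * c) \<le> sqrt ((W' + 1 + c)\<^sup>2 - 4 * c)"
    by simp
  then show ?thesis
    unfolding tie_root_def using assms sqrt_discriminant_ge[of c W]
    by (intro divide_strict_left_mono mult_pos_pos) linarith+
qed

lemma tie_root_quadratic:
  assumes "c > 0" "W \<ge> 0"
  shows "c * (tie_root c W)\<^sup>2 - (W + 1 + c) * tie_root c W + 1 = 0"
proof -
  define s where "s = sqrt ((W + 1 + c)\<^sup>2 - 4 * c)"
  have "(W + 1 + c)\<^sup>2 - 4 * c \<ge> 0"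
    using discriminant_ge[OF assms] zero_le_power2[of "1 - c"] by linarith
  then have ss: "s * s = (W + 1 + c)\<^sup>2 - 4 * c" by (simp add: s_def)
  define r where "r = tie_root c W"
  \<comment> \<open>Solving the closed form for \<open>s\<close> and substituting into the equation
    for \<open>s * s\<close> yields the quadratic, up to the factor \<open>4 * c\<close>.\<close>
  have "2 * c * r = W + 1 + c - s"
    using tie_root_eq[OF assms] assms by (simp add: r_def s_def field_simps)
  then have s: "s = W + 1 + c - 2 * c * r" by simp
  have "4 * c * (c * r\<^sup>2 - (W + 1 + c) * r + 1) = 0"
    using ss unfolding s by (simp add: power2_eq_square algebra_simps)
  then show ?thesis using assms by (simp add: r_def)
qed

section \<open>Maximisation over a single strategy\<close>

text \<open>Concavity enters through \<open>ln t \<le> t - 1\<close>, with equality only at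
  \<open>t = 1\<close>: each logarithm lies below its tangent at the root \<open>r\<close>, strictly
  for \<open>ln x\<close>. The resulting linear bound has slope 0 if \<open>r < 1\<close>; if
  \<open>r = 1\<close> its slope is nonnegative and \<open>x\<close> lies to the left of
  \<open>r\<close>.\<close>

lemma tie_root_maximal:
  fixes c W x :: real
  assumes c: "c > 0" and W: "W \<ge> 0" and x: "0 < x" "x \<le> 1" "W > 0 \<longrightarrow> x < 1"
    and ne: "x \<noteq> tie_root c W"
  shows "ln x - c * x + W * ln (1 - x)
    < ln (tie_root c W) - c * tie_root c W + W * ln (1 - tie_root c W)"
proof -
  define r where "r = tie_root c W"
  have r: "0 < r" "r \<le> 1" "W > 0 \<Longrightarrow> r < 1"
    using tie_root_pos tie_root_le_1 tie_root_less_1 c W by (auto simp: r_def)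
  have "x / r \<noteq> 1" using ne r by (simp add: r_def)
  then have "ln (x / r) < x / r - 1"
    using ln_le_minus_one[of "x / r"] ln_eq_minus_one[of "x / r"] x r
    by (metis divide_pos_pos order_less_le)
  then have 1: "ln x - ln r < (x - r) / r"
    using x r by (simp add: ln_div diff_divide_distrib)
  \<comment> \<open>If \<open>W = 0\<close>, both sides vanish, whatever the values of
    \<open>ln\<close> and of the quotient at 0.\<close>
  have 2: "W * (ln (1 - x) - ln (1 - r)) \<le> W * ((r - x) / (1 - r))"
  proof (cases "W > 0")
    case True
    then have "x < 1" "r < 1" using x r by auto
    then have "ln (1 - x) - ln (1 - r) \<le> (1 - x) / (1 - r) - 1"
      using ln_le_minus_one[of "(1 - x) / (1 - r)"] by (simp add: ln_div)
    also have "\<dots> = (r - x) / (1 - r)" using \<open>r < 1\<close> by (simp add: field_simps)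
    finally show ?thesis using W by (rule mult_left_mono)
  qed (use W in simp)
  have "(x - r) / r - c * (x - r) + W * ((r - x) / (1 - r)) \<le> 0"
  proof (cases "r < 1")
    case True
    \<comment> \<open>The quadratic regrouped; dividing by \<open>r * (1 - r)\<close> gives the
      first-order condition.\<close>
    have "1 - r - c * r * (1 - r) - W * r = 0"
      using tie_root_quadratic[OF c W] by (simp add: r_def power2_eq_square algebra_simps)
    then have "1 / r - c - W / (1 - r) = 0" using r True by (simp add: field_simps)
    moreover have "(x - r) / r - c * (x - r) + W * ((r - x) / (1 - r))
        = (x - r) * (1 / r - c - W / (1 - r))"
    proof -
      have "(r - x) / (1 - r) = - ((x - r) / (1 - r))"
        by (metis minus_diff_eq minus_divide_left)
      then show ?thesis by (simp add: algebra_simps)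
    qed
    ultimately show ?thesis by simp
  next
    case False
    \<comment> \<open>A positive \<open>W\<close> would push the root below 1, so only the slope
      \<open>1 - c\<close> at the right endpoint remains.\<close>
    then have "r = 1" "W = 0" using r W by fastforce+
    moreover have "c \<le> 1" using tie_root_eq_1D c W \<open>r = 1\<close> by (simp add: r_def)
    then have "(x - 1) * (1 - c) \<le> 0" using x by (simp add: mult_nonpos_nonneg)
    ultimately show ?thesis by (simp add: algebra_simps)
  qed
  with 1 2 show ?thesis unfolding r_def[symmetric] by (simp add: algebra_simps)
qed

section \<open>Grab probabilities after a unilateral change of strategy\<close>

lemma grab_prob_upd_self:
  "grab_prob interf (q(i := x)) i = x * (\<Prod>j\<in>interferers interf i. 1 - q j)"
  by (auto simp: grab_prob_def interferers_def intro!: prod.cong)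

lemma grab_prob_upd_interfered:
  assumes "j \<in> interfered interf i"
  shows "grab_prob interf (q(i := x)) j
    = (1 - x) * (q j * (\<Prod>k\<in>interferers interf j - {i}. 1 - q k))"
proof -
  have "i \<in> interferers interf j" "j \<noteq> i"
    using assms by (auto simp: interfered_def interferers_def)
  moreover have "(\<Prod>k\<in>interferers interf j - {i}. 1 - (q(i := x)) k)
      = (\<Prod>k\<in>interferers interf j - {i}. 1 - q k)"
    by (rule prod.cong) auto
  ultimately show ?thesis
    by (simp add: grab_prob_def prod.remove[where x = i])
qed

lemma grab_prob_upd_other:
  assumes "j \<noteq> i" "j \<notin> interfered interf i"
  shows "grab_prob interf (q(i := x)) j = grab_prob interf q j"
  using assms by (auto simp: grab_prob_def interfered_def interferers_def intro!: prod.cong)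

section \<open>When the social group utility is finite\<close>

text \<open>In \<open>ereal\<close> the sum of \<infinity> and -\<infinity> is \<infinity>, so
  -\<infinity> absorbs the sum only if no summand is \<infinity>.\<close>

lemma sum_ereal_eq_MInf:
  fixes f :: "'a \<Rightarrow> ereal"
  assumes "finite A" "a \<in> A" "f a = -\<infinity>" "\<And>x. x \<in> A \<Longrightarrow> f x \<noteq> \<infinity>"
  shows "sum f A = -\<infinity>"
proof -
  have "sum f (A - {a}) \<noteq> \<infinity>" using assms by (simp add: sum_Pinfty)
  then show ?thesis using assms by (simp add: sum.remove[of A a])
qed

text \<open>For positive \<open>z\<close> and nonnegative ties this is the dividing line between a
  real social group utility and the value -\<infinity>.\<close>

definition clear_channel ::
  "('u::finite \<Rightarrow> 'u \<Rightarrow> bool) \<Rightarrow> ('u \<Rightarrow> 'u \<Rightarrow> real) \<Rightarrow> ('u \<Rightarrow> real) \<Rightarrow> 'u \<Rightarrow> bool" where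
  "clear_channel interf w q i \<longleftrightarrow>
     (\<forall>j\<in>insert i (social_neighbours w i). grab_prob interf q j > 0)"

text \<open>The real counterpart of \<open>utility\<close>, meaningful only where the grab
  probability is positive; elsewhere it carries default values of \<open>ln\<close>.\<close>

definition finite_utility ::
  "('u::finite \<Rightarrow> 'u \<Rightarrow> bool) \<Rightarrow> ('u \<Rightarrow> real) \<Rightarrow> ('u \<Rightarrow> real) \<Rightarrow> ('u \<Rightarrow> real) \<Rightarrow> 'u \<Rightarrow> real" where
  "finite_utility interf z c q i = ln (z i * grab_prob interf q i) - c i * q i"

lemma utility_not_PInf: "utility interf z c q j \<noteq> \<infinity>"
  by (simp add: utility_def elog_def)

lemma social_group_utility_finite:
  assumes "\<And>k. z k > 0" "clear_channel interf w q i"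
  shows "social_group_utility interf z c w q i
    = ereal (finite_utility interf z c q i
        + (\<Sum>j\<in>social_neighbours w i. w i j * finite_utility interf z c q j))"
proof -
  have u: "utility interf z c q j = ereal (finite_utility interf z c q j)"
    if "j \<in> insert i (social_neighbours w i)" for j
    using that assms
    by (auto simp: clear_channel_def utility_def elog_def finite_utility_def)
  then have "(\<Sum>j\<in>social_neighbours w i. ereal (w i j) * utility interf z c q j)
      = ereal (\<Sum>j\<in>social_neighbours w i. w i j * finite_utility interf z c q j)"
    unfolding sum_ereal[symmetric] by (intro sum.cong) auto
  then show ?thesis using u[of i] by (simp add: social_group_utility_def)
qed

text \<open>Some user that counts has utility -\<infinity>. Its weight is positive, since social
  neighbours have nonzero ties, so its term stays -\<infinity>; nonnegative weights keep every other
  term away from \<infinity>, so nothing can offset it.\<close>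

lemma social_group_utility_MInf:
  assumes z: "\<And>k. z k > 0" and w: "\<And>j. w i j \<ge> 0"
    and nc: "\<not> clear_channel interf w q i"
  shows "social_group_utility interf z c w q i = -\<infinity>"
proof -
  obtain j where j: "j \<in> insert i (social_neighbours w i)" "\<not> grab_prob interf q j > 0"
    using nc by (auto simp: clear_channel_def)
  then have u: "utility interf z c q j = -\<infinity>"
    using z[of j] by (simp add: utility_def elog_def zero_less_mult_iff)
  have P: "ereal (w i k) * utility interf z c q k \<noteq> \<infinity>" for k
    using w[of k] utility_not_PInf[of interf z c q k]
    by (cases "utility interf z c q k") (auto simp: zero_less_mult_iff)
  show ?thesis
  proof (cases "j = i")
    case True
    then show ?thesis using u P by (simp add: social_group_utility_def sum_Pinfty)
  next
    case False
    then have "j \<in> social_neighbours w i" "w i j > 0"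
      using j w[of j] by (auto simp: social_neighbours_def)
    then have "(\<Sum>k\<in>social_neighbours w i. ereal (w i k) * utility interf z c q k) = -\<infinity>"
      using u P by (intro sum_ereal_eq_MInf[of _ j]) auto
    then show ?thesis using utility_not_PInf[of interf z c q i]
      by (simp add: social_group_utility_def)
  qed
qed

text \<open>The endpoints are excluded because 0 makes the user's own grab probability vanish, and 1
  makes that of every user it interferes with vanish.\<close>

lemma clear_channel_updD:
  assumes "clear_channel interf w (q(i := x)) i" "x \<in> {0..1}"
  shows "x > 0"
    and "j \<in> interfered interf i \<Longrightarrow> w i j \<noteq> 0 \<Longrightarrow> x < 1"
proof -
  show "x > 0"
    using assms by (cases "x = 0") (auto simp: clear_channel_def grab_prob_upd_self)
  assume j: "j \<in> interfered interf i" "w i j \<noteq> 0"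
  then have "grab_prob interf (q(i := x)) j > 0"
    using assms by (auto simp: clear_channel_def social_neighbours_def interfered_def)
  then show "x < 1"
    using assms j by (cases "x = 1") (auto simp: grab_prob_upd_interfered)
qed

text \<open>The strategy enters the relevant grab probabilities only through a factor
  \<open>x\<close> or \<open>1 - x\<close>. The remaining factors are positive for \<open>x\<close>,
  hence also for \<open>y\<close>. This keeps the utility finite when moving to the candidate best
  response.\<close>

lemma clear_channel_upd:
  assumes "clear_channel interf w (q(i := x)) i" "x \<in> {0..1}"
    and y: "y > 0" "\<And>j. j \<in> interfered interf i \<Longrightarrow> w i j \<noteq> 0 \<Longrightarrow> y < 1"
  shows "clear_channel interf w (q(i := y)) i"
  unfolding clear_channel_def
proof
  fix j assume j: "j \<in> insert i (social_neighbours w i)"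
  then have *: "grab_prob interf (q(i := x)) j > 0"
    using assms(1) unfolding clear_channel_def by blast
  consider "j = i" | "j \<in> interfered interf i" "j \<noteq> i"
    | "j \<notin> interfered interf i" "j \<noteq> i" by blast
  then show "grab_prob interf (q(i := y)) j > 0"
  proof cases
    case 1
    then show ?thesis using * y clear_channel_updD(1)[OF assms(1,2)]
      by (auto simp: grab_prob_upd_self zero_less_mult_iff)
  next
    case 2
    then have "w i j \<noteq> 0" using j by (auto simp: social_neighbours_def)
    then have "y < 1" "x < 1" using y 2 clear_channel_updD(2)[OF assms(1,2)] by auto
    then show ?thesis using * 2
      by (auto simp: grab_prob_upd_interfered zero_less_mult_iff)
  next
    case 3
    then show ?thesis using * by (simp add: grab_prob_upd_other)
  qed
qed

section \<open>Social group utility as a function of one strategy\<close>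

lemma finite_utility_upd_self:
  assumes "z i > 0" "grab_prob interf (q(i := x)) i > 0" "x > 0"
  shows "finite_utility interf z c (q(i := x)) i
    = ln x - c i * x + ln (z i * (\<Prod>j\<in>interferers interf i. 1 - q j))"
proof -
  define P where "P = (\<Prod>j\<in>interferers interf i. 1 - q j)"
  have P: "P > 0" using assms by (simp add: grab_prob_upd_self P_def zero_less_mult_iff)
  have "ln (z i * (x * P)) = ln x + ln (z i * P)"
    using assms P by (simp add: ln_mult)
  then show ?thesis
    by (simp add: finite_utility_def grab_prob_upd_self P_def)
qed

lemma finite_utility_upd_interfered:
  assumes "j \<in> interfered interf i" "z j > 0" "grab_prob interf (q(i := x)) j > 0" "x < 1"
  shows "finite_utility interf z c (q(i := x)) j = ln (1 - x)
    + (ln (z j * (q j * (\<Prod>k\<in>interferers interf j - {i}. 1 - q k))) - c j * q j)"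
proof -
  define P where "P = q j * (\<Prod>k\<in>interferers interf j - {i}. 1 - q k)"
  have e: "grab_prob interf (q(i := x)) j = (1 - x) * P"
    using grab_prob_upd_interfered[OF assms(1)] by (simp add: P_def)
  have P: "P > 0" using assms unfolding e by (simp add: zero_less_mult_iff)
  have "ln (z j * ((1 - x) * P)) = ln (1 - x) + ln (z j * P)"
    using assms P by (simp add: ln_mult)
  moreover have "j \<noteq> i" using assms by (simp add: interfered_def)
  ultimately show ?thesis
    unfolding finite_utility_def e by (simp add: P_def)
qed

lemma finite_utility_upd_other:
  assumes "j \<noteq> i" "j \<notin> interfered interf i"
  shows "finite_utility interf z c (q(i := x)) j = finite_utility interf z c q j"
  using assms by (simp add: finite_utility_def grab_prob_upd_other)

lemma social_group_utility_upd:
  assumes z: "\<And>k. z k > 0"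
  obtains K where "\<And>x. x \<in> {0..1} \<Longrightarrow> clear_channel interf w (q(i := x)) i \<Longrightarrow>
    social_group_utility interf z c w (q(i := x)) i
      = ereal (K + (ln x - c i * x + (\<Sum>j\<in>interfered interf i. w i j) * ln (1 - x)))"
proof -
  \<comment> \<open>\<open>K0 j\<close> is the part of the utility of \<open>j\<close> that does not
    depend on \<open>x\<close>: for an interfered user, what is left after splitting off
    \<open>ln (1 - x)\<close>.\<close>
  define K0 where "K0 j = (if j \<in> interfered interf i
    then ln (z j * (q j * (\<Prod>k\<in>interferers interf j - {i}. 1 - q k))) - c j * q j
    else finite_utility interf z c q j)" for j
  define N where "N = social_neighbours w i"
  show ?thesis
  proof (rule that[of "ln (z i * (\<Prod>j\<in>interferers interf i. 1 - q j)) + (\<Sum>j\<in>N. w i j * K0 j)"])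
    fix x :: real
    assume x: "x \<in> {0..1}" and cl: "clear_channel interf w (q(i := x)) i"
    have pos: "grab_prob interf (q(i := x)) j > 0" if "j \<in> insert i N" for j
      using cl that by (auto simp: clear_channel_def N_def)
    have "w i j * finite_utility interf z c (q(i := x)) j
        = w i j * K0 j + (if j \<in> interfered interf i then w i j * ln (1 - x) else 0)"
      if "j \<in> N" for j
    proof -
      have "j \<noteq> i" "w i j \<noteq> 0" using that by (auto simp: N_def social_neighbours_def)
      then show ?thesis
        using that z pos clear_channel_updD(2)[OF cl x]
        by (simp add: K0_def finite_utility_upd_interfered finite_utility_upd_other algebra_simps)
    qed
    then have "(\<Sum>j\<in>N. w i j * finite_utility interf z c (q(i := x)) j)
        = (\<Sum>j\<in>N. w i j * K0 j)
          + (\<Sum>j\<in>N. if j \<in> interfered interf i then w i j * ln (1 - x) else 0)"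
      by (simp add: sum.distrib)
    \<comment> \<open>The two index sets differ only in terms that vanish: social neighbours that
      are not interfered with contribute 0, and interfered users outside \<open>N\<close> have tie
      0.\<close>
    moreover have "(\<Sum>j\<in>N. if j \<in> interfered interf i then w i j * ln (1 - x) else 0)
        = (\<Sum>j\<in>interfered interf i. w i j * ln (1 - x))"
      by (rule sum.mono_neutral_cong)
        (auto simp: N_def social_neighbours_def interfered_def)
    ultimately show "social_group_utility interf z c w (q(i := x)) i = ereal
        (ln (z i * (\<Prod>j\<in>interferers interf i. 1 - q j)) + (\<Sum>j\<in>N. w i j * K0 j)
         + (ln x - c i * x + (\<Sum>j\<in>interfered interf i. w i j) * ln (1 - x)))"
      using social_group_utility_finite[OF z cl, where c = c]
        finite_utility_upd_self[of z i interf q x c] z[of i] pos[of i] clear_channel_updD(1)[OF cl x]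
      by (simp add: N_def[symmetric] sum_distrib_right)
  qed
qed

section \<open>Best responses and equilibria\<close>

lemma q_SNE_eq_tie_root:
  assumes "c i > 0" "\<And>j. w i j \<ge> 0"
  shows "q_SNE interf c w i = tie_root (c i) (\<Sum>j\<in>interfered interf i. w i j)"
  using assms by (simp add: q_SNE_def Let_def tie_root_eq sum_nonneg)

lemma q_SNE_bounds:
  assumes "c i > 0" "\<And>j. w i j \<ge> 0"
  shows "q_SNE interf c w i > 0" "q_SNE interf c w i \<le> 1"
    and "j \<in> interfered interf i \<Longrightarrow> w i j \<noteq> 0 \<Longrightarrow> q_SNE interf c w i < 1"
proof -
  show "q_SNE interf c w i > 0" "q_SNE interf c w i \<le> 1"
    using assms by (auto simp: q_SNE_eq_tie_root sum_nonneg tie_root_pos tie_root_le_1)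
  assume "j \<in> interfered interf i" "w i j \<noteq> 0"
  then have "(\<Sum>j\<in>interfered interf i. w i j) > 0"
    using assms by (intro sum_pos2[of _ j]) (auto simp: order_less_le)
  then show "q_SNE interf c w i < 1"
    using assms by (simp add: q_SNE_eq_tie_root tie_root_less_1)
qed

text \<open>The others' strategies affect only the additive constant \<open>K\<close>, so the same
  strategy is optimal against all of them. Finiteness at \<open>x\<close> makes the channel clear
  there and hence at \<open>q_SNE\<close>, which reduces the claim to
  \<open>tie_root_maximal\<close>.\<close>

lemma q_SNE_unique_best_response:
  assumes z: "\<And>k. z k > 0" and c: "c i > 0" and w: "\<And>j. w i j \<ge> 0"
    and x: "x \<in> {0..1}" "x \<noteq> q_SNE interf c w i"
    and fin: "social_group_utility interf z c w (q(i := x)) i \<noteq> -\<infinity>"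
  shows "social_group_utility interf z c w (q(i := x)) i
    < social_group_utility interf z c w (q(i := q_SNE interf c w i)) i"
proof -
  define r where "r = q_SNE interf c w i"
  define W where "W = (\<Sum>j\<in>interfered interf i. w i j)"
  obtain K where K: "\<And>x. x \<in> {0..1} \<Longrightarrow> clear_channel interf w (q(i := x)) i \<Longrightarrow>
    social_group_utility interf z c w (q(i := x)) i
      = ereal (K + (ln x - c i * x + W * ln (1 - x)))"
    unfolding W_def
    by (rule social_group_utility_upd[where z = z and c = c and w = w and q = q and i = i
          and interf = interf]) (use z in auto)
  have clx: "clear_channel interf w (q(i := x)) i"
    using social_group_utility_MInf[of z w i interf "q(i := x)" c] z w fin by blast
  have r: "r > 0" "r \<le> 1" "\<And>j. j \<in> interfered interf i \<Longrightarrow> w i j \<noteq> 0 \<Longrightarrow> r < 1"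
    using q_SNE_bounds[of c i w, OF c w] by (auto simp: r_def)
  have clr: "clear_channel interf w (q(i := r)) i"
    using clear_channel_upd[OF clx x(1)] r by blast
  have W0: "W \<ge> 0" using w by (simp add: W_def sum_nonneg)
  have "W > 0 \<longrightarrow> x < 1"
  proof
    assume "W > 0"
    then obtain j where "j \<in> interfered interf i" "w i j \<noteq> 0"
      unfolding W_def by (metis less_irrefl sum.neutral)
    then show "x < 1" using clear_channel_updD(2)[OF clx x(1)] by blast
  qed
  then have "ln x - c i * x + W * ln (1 - x) < ln r - c i * r + W * ln (1 - r)"
    using tie_root_maximal[OF c W0, of x] x clear_channel_updD(1)[OF clx x(1)]
      q_SNE_eq_tie_root[of c i w interf, OF c w] by (simp add: r_def W_def)
  then show ?thesis
    using K[OF x(1) clx] K[OF _ clr] r by (simp add: r_def)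
qed

lemma q_SNE_is_SNE:
  assumes "\<And>k. z k > 0" "\<And>k. c k > 0" "\<And>k j. w k j \<ge> 0"
  shows "is_SNE interf z c w (q_SNE interf c w)"
  unfolding is_SNE_def nash_equilibrium_def
proof (intro conjI allI ballI)
  fix i
  show "q_SNE interf c w i \<in> {0..1}"
    using q_SNE_bounds(1,2)[of c i w interf] assms by (simp add: less_imp_le)
next
  fix i and x :: real
  assume x: "x \<in> {0..1}"
  let ?q = "q_SNE interf c w"
  show "\<not> social_group_utility interf z c w ?q i
      < social_group_utility interf z c w (?q(i := x)) i"
  \<comment> \<open>Keeping the strategy changes nothing and dropping to -\<infinity> cannot help;
    any other deviation is strictly worse.\<close>
  proof (cases "x = ?q i \<or> social_group_utility interf z c w (?q(i := x)) i = -\<infinity>")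
    case False
    then show ?thesis
      using q_SNE_unique_best_response[of z c i w x interf ?q] assms x by auto
  qed auto
qed

text \<open>Finiteness excludes degenerate equilibria: if two mutually interfering users, the only
  ones, both transmit with probability 1, both utilities are -\<infinity> and neither can change
  this alone. Otherwise a different strategy would improve by switching to the best
  response.\<close>

lemma is_SNE_unique:
  assumes "\<And>k. z k > 0" "c i > 0" "\<And>j. w i j \<ge> 0"
    and sne: "is_SNE interf z c w q" and fin: "social_group_utility interf z c w q i \<noteq> -\<infinity>"
  shows "q i = q_SNE interf c w i"
proof (rule ccontr)
  assume ne: "q i \<noteq> q_SNE interf c w i"
  have "q_SNE interf c w i \<in> {0..1}"
    using q_SNE_bounds(1,2)[of c i w interf] assms by (simp add: less_imp_le)
  then have "\<not> social_group_utility interf z c w q i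
      < social_group_utility interf z c w (q(i := q_SNE interf c w i)) i"
    and "q i \<in> {0..1}"
    using sne unfolding is_SNE_def nash_equilibrium_def by blast+
  then show False
    using q_SNE_unique_best_response[of z c i w "q i" interf q] assms ne by simp
qed

section \<open>Monotonicity in the social ties\<close>

text \<open>The ties enter only through their sum over the interfered users, so one strict increase
  inside that set makes the sum, and hence the root, change strictly.\<close>

lemma q_SNE_strict_antimono:
  assumes "c i > 0" "\<And>j. w i j \<ge> 0" "\<And>j. w' i j \<ge> 0"
    and "\<And>j. j \<noteq> i \<Longrightarrow> w i j \<le> w' i j"
    and "j \<in> interfered interf i" "w i j < w' i j"
  shows "q_SNE interf c w' i < q_SNE interf c w i"
proof -
  have "(\<Sum>j\<in>interfered interf i. w i j) < (\<Sum>j\<in>interfered interf i. w' i j)"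
    using assms by (intro sum_strict_mono_ex1) (auto simp: interfered_def)
  then show ?thesis
    using assms by (simp add: q_SNE_eq_tie_root sum_nonneg tie_root_strict_antimono)
qed

lemma q_SNE_antimono:
  assumes "c i > 0" "\<And>j. w i j \<ge> 0" "\<And>j. w' i j \<ge> 0"
    and "\<And>j. j \<noteq> i \<Longrightarrow> w i j \<le> w' i j"
  shows "q_SNE interf c w' i \<le> q_SNE interf c w i"
proof (cases "\<exists>j\<in>interfered interf i. w i j < w' i j")
  case True
  then show ?thesis using q_SNE_strict_antimono[of c i w w'] assms by (blast intro: less_imp_le)
next
  case False
  \<comment> \<open>Without a strict increase the ties to interfered users agree, so both strategies
    are given by the same formula.\<close>
  then have "w i j = w' i j" if "j \<in> interfered interf i" for j
    using that assms(4)[of j] by (force simp: interfered_def)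
  then show ?thesis by (simp add: q_SNE_def)
qed

theorem corollary3:
  fixes interf :: "'u::finite \<Rightarrow> 'u \<Rightarrow> bool"
    and z c :: "'u \<Rightarrow> real"
    and w w' :: "'u \<Rightarrow> 'u \<Rightarrow> real"
    and i :: 'u
  assumes "\<And>k. z k > 0" and "\<And>k. c k > 0"
    and "\<And>k j. w k j \<in> {0..1}" and "\<And>k j. w' k j \<in> {0..1}"
    and "\<And>j. j \<noteq> i \<Longrightarrow> w i j \<le> w' i j"
  shows "is_SNE interf z c w (q_SNE interf c w)
    \<and> is_SNE interf z c w' (q_SNE interf c w')
    \<and> (\<forall>q. is_SNE interf z c w q \<and> social_group_utility interf z c w q i \<noteq> -\<infinity>
           \<longrightarrow> q i = q_SNE interf c w i)
    \<and> (\<forall>q'. is_SNE interf z c w' q' \<and> social_group_utility interf z c w' q' i \<noteq> -\<infinity>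
           \<longrightarrow> q' i = q_SNE interf c w' i)
    \<and> q_SNE interf c w' i \<le> q_SNE interf c w i
    \<and> ((\<exists>j\<in>interfered interf i. w i j < w' i j)
           \<longrightarrow> q_SNE interf c w' i < q_SNE interf c w i)"
proof -
  have w: "w k j \<ge> 0" "w' k j \<ge> 0" for k j using assms(3,4)[of k j] by auto
  show ?thesis
  proof (intro conjI allI impI)
    show "is_SNE interf z c w (q_SNE interf c w)"
      by (rule q_SNE_is_SNE) (use assms(1,2) w in auto)
    show "is_SNE interf z c w' (q_SNE interf c w')"
      by (rule q_SNE_is_SNE) (use assms(1,2) w in auto)
    show "q i = q_SNE interf c w i"
      if "is_SNE interf z c w q \<and> social_group_utility interf z c w q i \<noteq> -\<infinity>" for q
      by (rule is_SNE_unique[where z = z]) (use assms(1,2) w that in auto)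
    show "q i = q_SNE interf c w' i"
      if "is_SNE interf z c w' q \<and> social_group_utility interf z c w' q i \<noteq> -\<infinity>" for q
      by (rule is_SNE_unique[where z = z]) (use assms(1,2) w that in auto)
    show "q_SNE interf c w' i \<le> q_SNE interf c w i"
      by (rule q_SNE_antimono) (use assms(2,5) w in auto)
    show "q_SNE interf c w' i < q_SNE interf c w i"
      if ex: "\<exists>j\<in>interfered interf i. w i j < w' i j"
    proof -
      obtain j where "j \<in> interfered interf i" "w i j < w' i j" using ex by blast
      then show ?thesis
        by (intro q_SNE_strict_antimono) (use assms(2,5) w in auto)
    qed
  qed
qed

end
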